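(* Let $n \geq 3$ be an odd integer and let $\beta : S^n \to S^n$ be a minimal homeomorphism. Then there is a uniquely ergodic minimal homeomorphism $\alpha : X \to X$ of a Cantor set $X$ such that the homeomorphism $\alpha \times \beta : X \times S^n \to X \times S^n$, $(\alpha\times\beta)(x,t) = (\alpha(x),\beta(t))$, is minimal.
   Context: A homeomorphism of a compact metrizable space is minimal if every orbit is dense, and uniquely ergodic if it has exactly one invariant Borel probability measure. *)

theory Defs
  imports "HOL-Analysis.Analysis" "HOL-Probability.Probability"
begin

text \<open>
  Spaces are subsets of a topological type, with the subspace topology. Self-maps of a space
  \<open>X\<close> are total functions on the ambient type of which only the values on \<open>X\<close> matter.
\<close>

definition self_homeomorphism :: "'a::topological_space set \<Rightarrow> ('a \<Rightarrow> 'a) \<Rightarrow> bool" where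
  "self_homeomorphism X f \<longleftrightarrow> (\<exists>g. homeomorphism X X f g)"

text \<open>The two-sided orbit; \<open>inv_into X f\<close> is the inverse of the bijection \<open>f\<close> of \<open>X\<close>.\<close>

definition full_orbit :: "'a set \<Rightarrow> ('a \<Rightarrow> 'a) \<Rightarrow> 'a \<Rightarrow> 'a set" where
  "full_orbit X f x = range (\<lambda>k::nat. (f ^^ k) x) \<union> range (\<lambda>k::nat. (inv_into X f ^^ k) x)"

text \<open>For \<open>f\<close> a homeomorphism of \<open>X\<close> and \<open>x \<in> X\<close> the orbit lies in \<open>X\<close>, so it is dense in \<open>X\<close>
  if and only if its closure in the ambient space contains \<open>X\<close>.\<close>

definition minimal_homeomorphism :: "'a::topological_space set \<Rightarrow> ('a \<Rightarrow> 'a) \<Rightarrow> bool" where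
  "minimal_homeomorphism X f \<longleftrightarrow>
     self_homeomorphism X f \<and> (\<forall>x\<in>X. X \<subseteq> closure (full_orbit X f x))"

definition invariant_borel_prob ::
    "'a::topological_space set \<Rightarrow> ('a \<Rightarrow> 'a) \<Rightarrow> 'a measure \<Rightarrow> bool" where
  "invariant_borel_prob X f M \<longleftrightarrow>
     sets M = sets (restrict_space borel X) \<and> prob_space M \<and> distr M M f = M"

definition uniquely_ergodic :: "'a::topological_space set \<Rightarrow> ('a \<Rightarrow> 'a) \<Rightarrow> bool" where
  "uniquely_ergodic X f \<longleftrightarrow> self_homeomorphism X f \<and> (\<exists>!M. invariant_borel_prob X f M)"

text \<open>Here \<open>nat \<Rightarrow> bool\<close> carries the product of the discrete topologies.\<close>

definition Cantor_set :: "'a::topological_space set \<Rightarrow> bool" where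
  "Cantor_set X \<longleftrightarrow> X homeomorphic (UNIV :: (nat \<Rightarrow> bool) set)"

end

theory Submission
  imports Defs
begin

text \<open>
  The Cantor system is the binary odometer, the map \<open>x \<mapsto> x + 1\<close> on the 2-adic integers, where
  \<open>\<Sum> x\<^sub>k 2\<^sup>k\<close> is written as its sequence of binary digits. Modulo \<open>2\<^sup>m\<close> it is the cyclic
  permutation \<open>j \<mapsto> j + 1\<close> of the residues, so it permutes the \<open>2\<^sup>m\<close> cylinders fixed by the first
  \<open>m\<close> digits in one cycle.

  The sphere enters through its connectedness, which rules out a common finite factor of \<open>\<beta>\<close> and the
  odometer. A minimal homeomorphism of a connected space has a minimal square
  (\<open>minimal_homeomorphism_comp_self\<close>): a nonempty set invariant under \<open>f \<circ> f\<close> and its image under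
  \<open>f\<close> have closures that cover the space, hence meet, and they meet in a closed \<open>f\<close>-invariant set,
  which is everything. So all powers \<open>\<beta> ^^ (2 ^ m)\<close> are minimal.

  Let \<open>A\<close> be a nonempty invariant set of the product system. The points \<open>t\<close> that lie over a fixed
  cylinder of level \<open>m\<close> in \<open>A\<close> form a set that is invariant under \<open>\<beta> ^^ (2 ^ m)\<close>, because the
  odometer returns to that cylinder after exactly \<open>2 ^ m\<close> steps. This set is dense in the sphere, so
  \<open>A\<close> meets every product of a cylinder with an open set
  (\<open>minimal_homeomorphism_odometer_prod\<close>). The odometer itself is minimal as a factor of the product.

  An invariant probability measure gives the \<open>2\<^sup>m\<close> cyclically permuted cylinders of level \<open>m\<close> the
  same mass \<open>1 / 2\<^sup>m\<close> (\<open>emeasure_cylinder_invariant\<close>), and cylinders generate the Borel sets, so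
  there is at most one such measure. The distribution of a sequence of independent fair coin flips
  has these values on cylinders and is therefore invariant.
\<close>

section \<open>Minimality and invariant sets\<close>

lemma image_Int_closure_homeomorphism:
  assumes f: "self_homeomorphism X f" and A: "A \<subseteq> X"
  shows "f ` (X \<inter> closure A) = X \<inter> closure (f ` A)"
proof -
  obtain g where g: "homeomorphism X X f g"
    using f by (auto simp: self_homeomorphism_def)
  have rel: "top_of_set X closure_of B = X \<inter> closure B" if "B \<subseteq> X" for B
    using that by (simp add: closure_of_subtopology inf.absorb2)
  have "homeomorphic_map (top_of_set X) (top_of_set X) f"
    unfolding homeomorphic_map_maps homeomorphic_maps_def
    using g by (intro exI[of _ g]) (auto simp: homeomorphism_def)
  from homeomorphic_map_closure_of[OF this, of A]
  have "top_of_set X closure_of (f ` A) = f ` (top_of_set X closure_of A)"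
    using A by simp
  moreover have "f ` A \<subseteq> X"
    using g A by (auto simp: homeomorphism_def)
  ultimately show ?thesis
    using A by (simp add: rel)
qed

text \<open>
  The full orbit of a point is the smallest invariant set that contains it. Stated with
  arbitrary invariant sets, minimality no longer refers to forward and backward iterates and applies
  directly to projections, which may fail to be closed.
\<close>

lemma minimal_homeomorphism_iff_invariant_dense:
  "minimal_homeomorphism X f \<longleftrightarrow> self_homeomorphism X f \<and>
     (\<forall>A. A \<subseteq> X \<longrightarrow> A \<noteq> {} \<longrightarrow> f ` A = A \<longrightarrow> X \<subseteq> closure A)"
proof -
  have "(\<forall>x\<in>X. X \<subseteq> closure (full_orbit X f x)) \<longleftrightarrow>
        (\<forall>A. A \<subseteq> X \<longrightarrow> A \<noteq> {} \<longrightarrow> f ` A = A \<longrightarrow> X \<subseteq> closure A)"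
    if "self_homeomorphism X f"
  proof -
    from that have bij: "inj_on f X" "f ` X = X"
      unfolding self_homeomorphism_def homeomorphism_def by (metis inj_on_inverseI, blast)
    have f_inv: "f (inv_into X f x) = x" "inv_into X f x \<in> X" if "x \<in> X" for x
      using bij that by (auto simp: f_inv_into_f inv_into_into)
    show ?thesis
    proof (intro iffI allI ballI impI)
      fix A assume dense: "\<forall>x\<in>X. X \<subseteq> closure (full_orbit X f x)"
        and A: "A \<subseteq> X" "A \<noteq> {}" "f ` A = A"
      from A obtain x where x: "x \<in> A" by blast
      have "(f ^^ k) x \<in> A" for k
        by (induction k) (use x A(3) in auto)
      moreover have inv_A: "inv_into X f y \<in> A" if "y \<in> A" for y
      proof -
        have "y \<in> f ` A"
          using that by (simp only: A(3))
        then obtain a where a: "a \<in> A" "y = f a"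
          by blast
        then have "inv_into X f y = a"
          using A(1) bij(1) by (simp add: inv_into_f_f subset_iff)
        then show ?thesis
          using a by simp
      qed
      have "(inv_into X f ^^ k) x \<in> A" for k
        by (induction k) (simp_all add: x inv_A)
      ultimately have "full_orbit X f x \<subseteq> A"
        by (auto simp: full_orbit_def)
      then show "X \<subseteq> closure A"
        using dense x A by (meson closure_mono subset_iff)
    next
      fix x assume inv: "\<forall>A. A \<subseteq> X \<longrightarrow> A \<noteq> {} \<longrightarrow> f ` A = A \<longrightarrow> X \<subseteq> closure A"
        and x: "x \<in> X"
      let ?O = "full_orbit X f x"
      have fw: "(f ^^ k) x \<in> X" for k
        using x bij by (induction k) auto
      have bw: "(inv_into X f ^^ k) x \<in> X" for k
        using x f_inv by (induction k) auto
      have step_fw: "f ((f ^^ k) x) = (f ^^ Suc k) x" for k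
        by simp
      have step_bw: "f ((inv_into X f ^^ Suc k) x) = (inv_into X f ^^ k) x" for k
        using f_inv bw by simp
      have "f ` ?O = ?O"
      proof
        have "f ((inv_into X f ^^ k) x) \<in> ?O" for k
        proof (cases k)
          case 0
          then show ?thesis
            using step_fw[of 0] by (auto simp: full_orbit_def simp del: funpow.simps(2))
        next
          case (Suc j)
          then show ?thesis
            using step_bw[of j] by (auto simp: full_orbit_def simp del: funpow.simps(2))
        qed
        moreover have "f ((f ^^ k) x) \<in> ?O" for k
          by (metis UnI1 full_orbit_def rangeI step_fw)
        ultimately show "f ` ?O \<subseteq> ?O"
          unfolding full_orbit_def by blast
        have "(f ^^ k) x \<in> f ` ?O" for k
        proof (cases k)
          case 0
          have "(inv_into X f ^^ 1) x \<in> ?O"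
            unfolding full_orbit_def by blast
          then show ?thesis
            using step_bw[of 0] 0 by (metis One_nat_def funpow_0 imageI)
        next
          case (Suc j)
          then show ?thesis
            unfolding full_orbit_def by auto
        qed
        moreover have "(inv_into X f ^^ k) x \<in> f ` ?O" for k
          using step_bw[of k] by (metis UnI2 full_orbit_def imageI rangeI)
        ultimately show "?O \<subseteq> f ` ?O"
          unfolding full_orbit_def by blast
      qed
      moreover have "?O \<subseteq> X" "?O \<noteq> {}"
        using fw bw by (auto simp: full_orbit_def)
      ultimately show "X \<subseteq> closure ?O"
        using inv by blast
    qed
  qed
  then show ?thesis
    by (auto simp: minimal_homeomorphism_def)
qed

text \<open>
  Let \<open>F\<close> and \<open>G\<close> be the closures in \<open>X\<close> of a nonempty \<open>f \<circ> f\<close>-invariant set and of its image under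
  \<open>f\<close>. Then \<open>f\<close> exchanges \<open>F\<close> and \<open>G\<close>, so \<open>F \<union> G\<close> and \<open>F \<inter> G\<close> are \<open>f\<close>-invariant. The union is
  \<open>X\<close>, connectedness makes the intersection nonempty, and by minimality the intersection, being
  closed, is \<open>X\<close> as well.
\<close>

lemma minimal_homeomorphism_comp_self:
  assumes min: "minimal_homeomorphism X f" and "connected X"
  shows "minimal_homeomorphism X (f \<circ> f)"
  unfolding minimal_homeomorphism_iff_invariant_dense
proof (intro conjI allI impI)
  have f: "self_homeomorphism X f"
    using min by (simp add: minimal_homeomorphism_def)
  then show "self_homeomorphism X (f \<circ> f)"
    unfolding self_homeomorphism_def using homeomorphism_compose by blast
  have fX: "f ` X = X"
    using f by (auto simp: self_homeomorphism_def homeomorphism_def)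
  have inj: "inj_on f X"
    using f unfolding self_homeomorphism_def homeomorphism_def by (metis inj_on_inverseI)
  have dense: "X \<subseteq> closure B" if "B \<subseteq> X" "B \<noteq> {}" "f ` B = B" for B
    using min that by (auto simp: minimal_homeomorphism_iff_invariant_dense)
  fix A assume A: "A \<subseteq> X" "A \<noteq> {}" "(f \<circ> f) ` A = A"
  have fA: "f ` A \<subseteq> X" and ffA: "f ` f ` A = A"
    using A fX by (auto simp: image_comp)
  let ?F = "X \<inter> closure A" and ?G = "X \<inter> closure (f ` A)"
  have FG: "f ` ?F = ?G"
    by (rule image_Int_closure_homeomorphism[OF f A(1)])
  have GF: "f ` ?G = ?F"
    using image_Int_closure_homeomorphism[OF f fA] by (simp only: ffA)
  have cover: "X \<subseteq> closure A \<union> closure (f ` A)"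
    using dense[of "A \<union> f ` A"] A fA ffA by (simp add: image_Un Un_commute)
  have "?F \<inter> ?G \<noteq> {}"
  proof
    assume "?F \<inter> ?G = {}"
    then have "closure A \<inter> closure (f ` A) \<inter> X = {}"
      by blast
    moreover have "closure A \<inter> X \<noteq> {}" "closure (f ` A) \<inter> X \<noteq> {}"
      using A(1,2) fA closure_subset[of A] closure_subset[of "f ` A"] by blast+
    ultimately show False
      using connected_closedD[OF \<open>connected X\<close> _ cover closed_closure closed_closure] by simp
  qed
  moreover have "f ` (?F \<inter> ?G) = ?F \<inter> ?G"
    using inj_on_image_Int[OF inj Int_lower1 Int_lower1, of "closure A" "closure (f ` A)"]
    by (simp only: FG GF Int_commute)
  ultimately have "X \<subseteq> closure (?F \<inter> ?G)"
    using dense[of "?F \<inter> ?G"] by (simp add: le_infI1)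
  also have "\<dots> \<subseteq> closure (closure A)"
    by (intro closure_mono) blast
  also have "\<dots> = closure A"
    by simp
  finally show "X \<subseteq> closure A" .
qed

lemma minimal_homeomorphism_funpow_power2:
  assumes "minimal_homeomorphism X f" "connected X"
  shows "minimal_homeomorphism X (f ^^ (2 ^ m))"
proof (induction m)
  case 0
  then show ?case using assms by simp
next
  case (Suc m)
  have "f ^^ (2 ^ Suc m) = (f ^^ (2 ^ m)) \<circ> (f ^^ (2 ^ m))"
    by (simp add: mult_2 funpow_add)
  then show ?case
    using minimal_homeomorphism_comp_self[OF Suc \<open>connected X\<close>] by (simp only:)
qed

section \<open>The binary odometer\<close>

text \<open>
  Addition of \<open>1\<close> flips a digit precisely when a carry reaches it, that is, when all lower digits are
  \<open>1\<close>; subtraction of \<open>1\<close> flips it when a borrow does.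
\<close>

definition odometer :: "(nat \<Rightarrow> bool) \<Rightarrow> nat \<Rightarrow> bool" where
  "odometer x n \<longleftrightarrow> (x n \<noteq> (\<forall>k<n. x k))"

definition odometer_inv :: "(nat \<Rightarrow> bool) \<Rightarrow> nat \<Rightarrow> bool" where
  "odometer_inv x n \<longleftrightarrow> (x n \<noteq> (\<forall>k<n. \<not> x k))"

definition residue :: "nat \<Rightarrow> (nat \<Rightarrow> bool) \<Rightarrow> nat" where
  "residue m x = (\<Sum>k<m. of_bool (x k) * 2 ^ k)"

text \<open>
  Cylinders are indexed by a residue instead of a word, so that the odometer acts on the index as
  addition of \<open>1\<close> and the family of all cylinders is visibly countable. An index \<open>j \<ge> 2 ^ m\<close> gives
  the empty set.
\<close>

definition cylinder :: "nat \<Rightarrow> nat \<Rightarrow> (nat \<Rightarrow> bool) set" where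
  "cylinder m j = {x. residue m x = j}"

lemma residue_Suc: "residue (Suc m) x = residue m x + of_bool (x m) * 2 ^ m"
  by (simp add: residue_def)

lemma residue_less: "residue m x < 2 ^ m"
proof (induction m)
  case 0
  then show ?case by (simp add: residue_def)
next
  case (Suc m)
  then show ?case by (cases "x m") (simp_all add: residue_Suc)
qed

lemma residue_eq_iff: "residue m x = residue m y \<longleftrightarrow> (\<forall>k<m. x k = y k)"
proof (induction m)
  case 0
  then show ?case by (simp add: residue_def)
next
  case (Suc m)
  have "residue (Suc m) x = residue (Suc m) y \<longleftrightarrow> residue m x = residue m y \<and> x m = y m"
    using residue_less[of m x] residue_less[of m y]
    by (cases "x m"; cases "y m") (simp_all add: residue_Suc)
  then show ?case
    using Suc by (auto simp: less_Suc_eq)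
qed

lemma residue_mod:
  assumes "m \<le> m'"
  shows "residue m' x mod 2 ^ m = residue m x"
  using assms
proof (induction m' rule: dec_induct)
  case base
  then show ?case by (simp add: residue_less)
next
  case (step n)
  have "(2::nat) ^ m dvd 2 ^ n"
    using step by (simp add: le_imp_power_dvd)
  then have "(residue n x + of_bool (x n) * 2 ^ n) mod 2 ^ m = residue n x mod 2 ^ m"
    by (metis add.right_neutral dvd_mult mod_add_right_eq mod_0_imp_dvd dvd_imp_mod_0)
  then show ?case
    using step by (simp add: residue_Suc)
qed

lemma residue_eq_max_iff: "Suc (residue m x) = 2 ^ m \<longleftrightarrow> (\<forall>k<m. x k)"
proof (induction m)
  case 0
  then show ?case by (simp add: residue_def)
next
  case (Suc m)
  have "Suc (residue (Suc m) x) = 2 ^ Suc m \<longleftrightarrow> Suc (residue m x) = 2 ^ m \<and> x m"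
    using residue_less[of m x] by (cases "x m") (simp_all add: residue_Suc)
  then show ?case
    using Suc by (auto simp: less_Suc_eq)
qed

lemma residue_odometer: "residue m (odometer x) = Suc (residue m x) mod 2 ^ m"
proof (induction m)
  case 0
  then show ?case by (simp add: residue_def)
next
  case (Suc m)
  show ?case
  proof (cases "\<forall>k<m. x k")
    case True
    then have "Suc (residue m x) = 2 ^ m"
      by (simp add: residue_eq_max_iff)
    then have "Suc (residue m x + 2 ^ m) = 2 * 2 ^ m"
      by simp
    then have "Suc (residue m x + 2 ^ m) mod (2 * 2 ^ m) = 0"
      by (simp only: mod_self)
    moreover have "odometer x m \<longleftrightarrow> \<not> x m"
      using True by (simp add: odometer_def)
    ultimately show ?thesis
      using \<open>Suc (residue m x) = 2 ^ m\<close> Suc by (cases "x m") (simp_all add: residue_Suc)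
  next
    case False
    then have "Suc (residue m x) < 2 ^ m"
      using residue_less[of m x] residue_eq_max_iff[of m x] by (intro Suc_lessI) simp_all
    with False Suc show ?thesis
      by (cases "x m") (simp_all add: residue_Suc odometer_def)
  qed
qed

lemma residue_funpow_odometer:
  "residue m ((odometer ^^ i) x) = (residue m x + i) mod 2 ^ m"
  by (induction i) (auto simp: residue_less residue_odometer mod_Suc_eq)

lemma odometer_reaches_residue:
  assumes "j < 2 ^ m"
  obtains i where "residue m ((odometer ^^ i) x) = j"
proof
  have "residue m x + (j + (2 ^ m - residue m x)) = j + 2 ^ m"
    using residue_less[of m x] by simp
  then show "residue m ((odometer ^^ (j + (2 ^ m - residue m x))) x) = j"
    using assms by (simp add: residue_funpow_odometer)
qed

lemma odometer_inv_odometer: "odometer_inv (odometer x) = x"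
proof
  fix n
  have "(\<forall>k<n. \<not> odometer x k) \<longleftrightarrow> (\<forall>k<n. x k)" for n
  proof (induction n)
    case (Suc n)
    then show ?case
      unfolding All_less_Suc odometer_def[of x n] by blast
  qed simp
  then show "odometer_inv (odometer x) n = x n"
    unfolding odometer_inv_def odometer_def[of x n] by blast
qed

lemma odometer_odometer_inv: "odometer (odometer_inv x) = x"
proof
  fix n
  have "(\<forall>k<n. odometer_inv x k) \<longleftrightarrow> (\<forall>k<n. \<not> x k)" for n
  proof (induction n)
    case (Suc n)
    then show ?case
      unfolding All_less_Suc odometer_inv_def[of x n] by blast
  qed simp
  then show "odometer (odometer_inv x) n = x n"
    unfolding odometer_def odometer_inv_def[of x n] by blast
qed

lemma cylinder_eq_PiE:
  "cylinder m (residue m y) = Pi\<^sub>E UNIV (\<lambda>k. if k \<in> {..<m} then {y k} else UNIV)"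
proof (rule set_eqI)
  fix z
  have "z \<in> Pi\<^sub>E UNIV (\<lambda>k. if k \<in> {..<m} then {y k} else UNIV) \<longleftrightarrow>
      (\<forall>k. z k \<in> (if k < m then {y k} else UNIV))"
    by (simp add: PiE_iff)
  also have "\<dots> \<longleftrightarrow> (\<forall>k<m. z k = y k)"
    by (simp add: if_split_mem2)
  finally show "z \<in> cylinder m (residue m y) \<longleftrightarrow>
      z \<in> Pi\<^sub>E UNIV (\<lambda>k. if k \<in> {..<m} then {y k} else UNIV)"
    by (simp add: cylinder_def residue_eq_iff)
qed

lemma open_cylinder: "open (cylinder m j)"
proof (cases "cylinder m j = {}")
  case False
  then obtain y where y: "residue m y = j"
    by (auto simp: cylinder_def)
  have "open (Pi\<^sub>E UNIV (\<lambda>k. if k \<in> {..<m} then {y k} else UNIV))"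
  proof (rule open_PiE)
    show "open (if k \<in> {..<m} then {y k} else UNIV)" for k
      by (rule discrete_topology_class.open_discrete)
    have "{k. (if k \<in> {..<m} then {y k} else UNIV) \<noteq> UNIV} \<subseteq> {..<m}"
      by auto
    then show "finite {k. (if k \<in> {..<m} then {y k} else UNIV) \<noteq> UNIV}"
      using finite_subset by blast
  qed
  then show ?thesis
    using y cylinder_eq_PiE[of m y] by simp
qed simp

lemma cylinder_subset_open:
  assumes "open U" "x \<in> U"
  shows "\<exists>m. cylinder m (residue m x) \<subseteq> U"
proof -
  have "openin (product_topology (\<lambda>i::nat. euclidean) UNIV) U"
    using assms by (simp add: open_fun_def)
  from product_topology_open_contains_basis[OF this \<open>x \<in> U\<close>]
  obtain V where V: "x \<in> Pi\<^sub>E UNIV V" "finite {i. V i \<noteq> UNIV}" "Pi\<^sub>E UNIV V \<subseteq> U"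
    by auto
  then obtain m where "{i. V i \<noteq> UNIV} \<subseteq> {..<m}"
    using finite_nat_iff_bounded by blast
  then have m: "V i = UNIV" if "i \<ge> m" for i
    using that by force
  have "cylinder m (residue m x) \<subseteq> Pi\<^sub>E UNIV V"
  proof
    fix z assume "z \<in> cylinder m (residue m x)"
    then have eq: "z k = x k" if "k < m" for k
      using that by (auto simp: cylinder_def residue_eq_iff)
    have "z k \<in> V k" for k
      using eq[of k] m[of k] V(1) by (cases "k < m") (auto simp: PiE_iff)
    then show "z \<in> Pi\<^sub>E UNIV V"
      by auto
  qed
  then show ?thesis
    using V(3) by blast
qed

text \<open>
  The hypothesis says that \<open>f\<close> is 1-Lipschitz for the 2-adic metric.
\<close>

lemma continuous_on_if_residue_preserving:
  assumes f: "\<And>m x y. residue m x = residue m y \<Longrightarrow> residue m (f x) = residue m (f y)"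
  shows "continuous_on UNIV f"
proof -
  have "open (f -` B)" if "open B" for B
  proof (subst open_subopen, intro ballI)
    fix x assume "x \<in> f -` B"
    then obtain m where m: "cylinder m (residue m (f x)) \<subseteq> B"
      using cylinder_subset_open[OF \<open>open B\<close>, of "f x"] by blast
    have sub: "f z \<in> B" if "z \<in> cylinder m (residue m x)" for z
    proof -
      have "residue m (f z) = residue m (f x)"
        using that by (intro f) (simp add: cylinder_def)
      then show ?thesis
        using m by (auto simp: cylinder_def)
    qed
    show "\<exists>T. open T \<and> x \<in> T \<and> T \<subseteq> f -` B"
    proof (intro exI conjI)
      show "open (cylinder m (residue m x))"
        by (rule open_cylinder)
      show "x \<in> cylinder m (residue m x)"
        by (simp add: cylinder_def)
      show "cylinder m (residue m x) \<subseteq> f -` B"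
        using sub by (intro subsetI vimageI2)
    qed
  qed
  then show ?thesis
    unfolding continuous_on_open_vimage[OF open_UNIV] Int_UNIV_right by blast
qed

lemma self_homeomorphism_odometer: "self_homeomorphism UNIV odometer"
proof -
  have "continuous_on UNIV odometer"
    by (rule continuous_on_if_residue_preserving) (simp add: residue_odometer)
  moreover have "continuous_on UNIV odometer_inv"
    by (rule continuous_on_if_residue_preserving) (auto simp: residue_eq_iff odometer_inv_def)
  moreover have "surj odometer" "surj odometer_inv"
    using odometer_inv_odometer odometer_odometer_inv by (metis surjI)+
  ultimately have "homeomorphism UNIV UNIV odometer odometer_inv"
    by (simp add: homeomorphism_def odometer_inv_odometer odometer_odometer_inv)
  then show ?thesis
    unfolding self_homeomorphism_def by blast
qed

section \<open>Products with the odometer\<close>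

lemma self_homeomorphism_prod:
  assumes "self_homeomorphism X f" "self_homeomorphism Y g"
  shows "self_homeomorphism (X \<times> Y) (\<lambda>(x, y). (f x, g y))"
proof -
  obtain f' g' where h: "homeomorphism X X f f'" "homeomorphism Y Y g g'"
    using assms by (auto simp: self_homeomorphism_def)
  have cont: "continuous_on (X \<times> Y) (\<lambda>(x, y). (u x, v y))"
    if "continuous_on X u" "continuous_on Y v" for u v
    unfolding case_prod_unfold
  proof (intro continuous_on_Pair)
    show "continuous_on (X \<times> Y) (\<lambda>p. u (fst p))"
      by (rule continuous_on_compose2[OF that(1)]) (auto intro: continuous_on_fst continuous_on_id)
    show "continuous_on (X \<times> Y) (\<lambda>p. v (snd p))"
      by (rule continuous_on_compose2[OF that(2)]) (auto intro: continuous_on_snd continuous_on_id)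
  qed
  have "homeomorphism (X \<times> Y) (X \<times> Y) (\<lambda>(x, y). (f x, g y)) (\<lambda>(x, y). (f' x, g' y))"
    unfolding homeomorphism_def[of "X \<times> Y"]
  proof (intro conjI cont)
    show "continuous_on X f" "continuous_on Y g" "continuous_on X f'" "continuous_on Y g'"
      using h by (simp_all add: homeomorphism_def)
    show "(\<lambda>(x, y). (f x, g y)) ` (X \<times> Y) = X \<times> Y" "(\<lambda>(x, y). (f' x, g' y)) ` (X \<times> Y) = X \<times> Y"
      using h by (simp_all add: homeomorphism_def image_paired_Times)
  qed (use h in \<open>auto simp: homeomorphism_def\<close>)
  then show ?thesis
    unfolding self_homeomorphism_def by blast
qed

text \<open>
  Minimality of all the powers \<open>g ^^ (2 ^ m)\<close> is what prevents a common finite factor of \<open>g\<close> and the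
  odometer: the first return to a cylinder of level \<open>m\<close> acts on the other coordinate as
  \<open>g ^^ (2 ^ m)\<close>.
\<close>

lemma minimal_homeomorphism_odometer_prod:
  assumes g: "self_homeomorphism Y g"
    and min: "\<And>m. minimal_homeomorphism Y (g ^^ (2 ^ m))"
  shows "minimal_homeomorphism (UNIV \<times> Y) (\<lambda>(x, t). (odometer x, g t))"
  unfolding minimal_homeomorphism_iff_invariant_dense
proof (intro conjI allI impI)
  let ?h = "\<lambda>(x, t). (odometer x, g t)"
  show "self_homeomorphism (UNIV \<times> Y) ?h"
    by (intro self_homeomorphism_prod self_homeomorphism_odometer g)
  fix A assume A: "A \<subseteq> UNIV \<times> Y" "A \<noteq> {}" "?h ` A = A"
  have funpow_h: "(?h ^^ i) (x, t) = ((odometer ^^ i) x, (g ^^ i) t)" for i x t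
    by (induction i) auto
  have funpow_A: "(?h ^^ i) ` A = A" for i
  proof (induction i)
    case (Suc i)
    have "(?h ^^ Suc i) ` A = ?h ` (?h ^^ i) ` A"
      by (simp only: funpow.simps image_comp)
    then show ?case
      using Suc A(3) by (simp only:)
  qed simp
  have iterate_in_A: "((odometer ^^ i) x, (g ^^ i) t) \<in> A" if "(x, t) \<in> A" for i x t
    using imageI[OF that, of "?h ^^ i"] by (simp only: funpow_A funpow_h)
  show "UNIV \<times> Y \<subseteq> closure A"
  proof
    fix p :: "(nat \<Rightarrow> bool) \<times> 'a" assume "p \<in> UNIV \<times> Y"
    then obtain y s where p: "p = (y, s)" "s \<in> Y" by auto
    show "p \<in> closure A"
    proof (rule ccontr)
      assume "p \<notin> closure A"
      then have "(y, s) \<in> - closure A"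
        using p(1) by simp
      then obtain U V where UV: "open U" "y \<in> U" "open V" "s \<in> V" "U \<times> V \<subseteq> - closure A"
        by (metis open_prod_elim closed_closure open_Compl mem_Sigma_iff)
      obtain m where m: "cylinder m (residue m y) \<subseteq> U"
        using cylinder_subset_open UV by blast
      \<comment> \<open>The part of \<open>A\<close> over the cylinder, projected to \<open>Y\<close>.\<close>
      define P where "P = {t. \<exists>x. residue m x = residue m y \<and> (x, t) \<in> A}"
      have period: "residue m ((odometer ^^ (2 ^ m)) x) = residue m x" for x
        by (simp add: residue_funpow_odometer residue_less)
      have "(g ^^ (2 ^ m)) ` P = P"
      proof (intro equalityI subsetI)
        fix t assume "t \<in> (g ^^ (2 ^ m)) ` P"
        then obtain x u where u: "t = (g ^^ (2 ^ m)) u" "residue m x = residue m y" "(x, u) \<in> A"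
          by (auto simp: P_def)
        then have "((odometer ^^ (2 ^ m)) x, t) \<in> A"
          by (simp only: iterate_in_A)
        then show "t \<in> P"
          using period[of x] u(2) unfolding P_def mem_Collect_eq by metis
      next
        fix t assume "t \<in> P"
        then obtain x where x: "residue m x = residue m y" "(x, t) \<in> A"
          by (auto simp: P_def)
        from x(2) have "(x, t) \<in> (?h ^^ (2 ^ m)) ` A"
          by (simp only: funpow_A)
        then obtain x' t' where "(x', t') \<in> A" "(x, t) = (?h ^^ (2 ^ m)) (x', t')"
          by (elim imageE) (metis surj_pair)
        then have "(x', t') \<in> A" "x = (odometer ^^ (2 ^ m)) x'" "t = (g ^^ (2 ^ m)) t'"
          by (simp_all only: funpow_h prod.inject)
        moreover from this have "t' \<in> P"
          using x(1) period[of x'] unfolding P_def mem_Collect_eq by metis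
        ultimately show "t \<in> (g ^^ (2 ^ m)) ` P"
          by blast
      qed
      moreover have "P \<noteq> {}"
      proof -
        obtain x t where xt: "(x, t) \<in> A"
          using A(2) by auto
        obtain i where "residue m ((odometer ^^ i) x) = residue m y"
          using odometer_reaches_residue[OF residue_less] by blast
        moreover have "((odometer ^^ i) x, (g ^^ i) t) \<in> A"
          by (rule iterate_in_A[OF xt])
        ultimately show ?thesis
          by (auto simp: P_def)
      qed
      moreover have "P \<subseteq> Y"
        using A(1) by (auto simp: P_def)
      ultimately have "s \<in> closure P"
        using min[of m] p(2) by (auto simp: minimal_homeomorphism_iff_invariant_dense)
      then obtain t where "t \<in> P" "t \<in> V"
        using UV by (metis closure_iff_nhds_not_empty disjoint_iff order_refl)
      then obtain x where "x \<in> cylinder m (residue m y)" "(x, t) \<in> A"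
        by (auto simp: P_def cylinder_def)
      then show False
        using m UV \<open>t \<in> V\<close> closure_subset[of A] by blast
    qed
  qed
qed

lemma minimal_homeomorphism_factor:
  assumes min: "minimal_homeomorphism (X \<times> Y) (\<lambda>(x, y). (f x, g y))"
    and f: "self_homeomorphism X f" and g: "g ` Y = Y" and "Y \<noteq> {}"
  shows "minimal_homeomorphism X f"
  unfolding minimal_homeomorphism_iff_invariant_dense
proof (intro conjI allI impI f)
  fix A assume A: "A \<subseteq> X" "A \<noteq> {}" "f ` A = A"
  have "(\<lambda>(x, y). (f x, g y)) ` (A \<times> Y) = A \<times> Y"
    using A g by (simp add: image_paired_Times)
  then have "X \<times> Y \<subseteq> closure (A \<times> Y)"
    using min A \<open>Y \<noteq> {}\<close> unfolding minimal_homeomorphism_iff_invariant_dense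
    by (metis Sigma_mono subset_refl Times_empty)
  then show "X \<subseteq> closure A"
    using \<open>Y \<noteq> {}\<close> by (auto simp: closure_Times)
qed

section \<open>Unique ergodicity of the odometer\<close>

lemma borel_eq_sigma_cylinders: "(borel :: (nat \<Rightarrow> bool) measure) = sigma UNIV (range (\<lambda>(m, j). cylinder m j))"
proof (rule borel_eq_countable_basis)
  show "topological_basis (range (\<lambda>(m, j). cylinder m j))"
  proof (rule topological_basisI)
    fix U :: "(nat \<Rightarrow> bool) set" and x assume "open U" "x \<in> U"
    then obtain m where "cylinder m (residue m x) \<subseteq> U"
      using cylinder_subset_open by blast
    moreover have "x \<in> cylinder m (residue m x)"
      by (simp add: cylinder_def)
    ultimately show "\<exists>B\<in>range (\<lambda>(m, j). cylinder m j). x \<in> B \<and> B \<subseteq> U"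
      by auto
  qed (auto simp: open_cylinder)
qed auto

text \<open>
  The residue modulo \<open>2 ^ m'\<close> determines the one modulo \<open>2 ^ m\<close> for \<open>m \<le> m'\<close>, so two cylinders are
  nested or disjoint.
\<close>

lemma Int_stable_cylinders: "Int_stable (range (\<lambda>(m, j). cylinder m j))"
proof -
  have *: "cylinder m j \<inter> cylinder m' j' \<in> range (\<lambda>(m, j). cylinder m j)" if "m \<le> m'" for m j m' j'
  proof (cases "j' mod 2 ^ m = j")
    case True
    then have "cylinder m j \<inter> cylinder m' j' = cylinder m' j'"
      using residue_mod[OF that] by (auto simp: cylinder_def)
    then show ?thesis by auto
  next
    case False
    then have "cylinder m j \<inter> cylinder m' j' = {}"
      using residue_mod[OF that] by (auto simp: cylinder_def)
    \<comment> \<open>At level \<open>0\<close> the only residue is \<open>0\<close>, so index \<open>1\<close> is out of range.\<close>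
    also have "{} = cylinder 0 1"
      by (simp add: cylinder_def residue_def)
    finally show ?thesis by auto
  qed
  then show ?thesis
    unfolding Int_stable_def by clarsimp (metis Int_commute nle_le)
qed

lemma prob_measure_eqI_cylinders:
  fixes M N :: "(nat \<Rightarrow> bool) measure"
  assumes "sets M = sets borel" "sets N = sets borel" "prob_space M" "prob_space N"
    and "\<And>m y. emeasure M (cylinder m (residue m y)) = emeasure N (cylinder m (residue m y))"
  shows "M = N"
proof (rule measure_eqI_generator_eq[OF Int_stable_cylinders, where \<Omega> = UNIV])
  let ?E = "range (\<lambda>(m, j). cylinder m j)"
  show "sets M = sigma_sets UNIV ?E" "sets N = sigma_sets UNIV ?E"
    using assms by (simp_all add: borel_eq_sigma_cylinders)
  show "emeasure M C = emeasure N C" if C: "C \<in> ?E" for C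
  proof (cases "C = {}")
    case False
    with C obtain m y where "C = cylinder m (residue m y)"
      by (auto simp: cylinder_def)
    then show ?thesis using assms by simp
  qed simp
  have "UNIV = cylinder 0 0"
    by (simp add: cylinder_def residue_def)
  then show "range (\<lambda>_::nat. UNIV) \<subseteq> ?E"
    by auto
  show "emeasure M UNIV \<noteq> \<infinity>"
    using prob_space.emeasure_le_1[OF assms(3), of UNIV] by (auto simp: top_unique)
qed auto

text \<open>
  Adding \<open>1\<close> is injective modulo \<open>2 ^ m\<close>.
\<close>

lemma vimage_odometer_cylinder:
  "odometer -` cylinder m (residue m (odometer y)) = cylinder m (residue m y)"
proof -
  have "residue m (odometer x) = residue m (odometer y) \<longleftrightarrow> residue m x = residue m y" for x
    using residue_less[of m x] residue_less[of m y]
    by (auto simp: residue_odometer mod_Suc)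
  then show ?thesis
    by (auto simp: cylinder_def)
qed

lemma measurable_odometer: "odometer \<in> borel_measurable borel"
  using self_homeomorphism_odometer
  by (auto simp: self_homeomorphism_def homeomorphism_def intro: borel_measurable_continuous_onI)

text \<open>
  The odometer carries any cylinder of level \<open>m\<close> to any other, so all \<open>2 ^ m\<close> of them have the same
  measure, and they partition the space.
\<close>

lemma emeasure_cylinder_invariant:
  assumes M: "invariant_borel_prob UNIV odometer M"
  shows "emeasure M (cylinder m (residue m y)) = ennreal (1 / 2 ^ m)"
proof -
  interpret prob_space M
    using M by (simp add: invariant_borel_prob_def)
  have sets_M: "sets M = sets borel" and inv: "distr M M odometer = M"
    using M by (simp_all add: invariant_borel_prob_def)
  have space_M: "space M = UNIV"
    using sets_eq_imp_space_eq[OF sets_M] by simp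
  have cyl[measurable]: "cylinder m j \<in> sets M" for j
    by (simp add: sets_M open_cylinder)
  have odo: "odometer \<in> measurable M M"
    using measurable_odometer by (simp add: measurable_cong_sets[OF sets_M sets_M])
  have step: "measure M (cylinder m (residue m (odometer z))) = measure M (cylinder m (residue m z))" for z
    using measure_distr[OF odo cyl, of "residue m (odometer z)"]
    by (simp add: inv space_M vimage_odometer_cylinder)
  have orbit: "measure M (cylinder m (residue m ((odometer ^^ i) y))) = measure M (cylinder m (residue m y))" for i
    by (induction i) (simp_all add: step)
  have const: "measure M (cylinder m j) = measure M (cylinder m (residue m y))" if "j < 2 ^ m" for j
  proof -
    obtain i where "residue m ((odometer ^^ i) y) = j"
      using odometer_reaches_residue[OF \<open>j < 2 ^ m\<close>] by blast
    then show ?thesis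
      using orbit[of i] by simp
  qed
  have "(\<Union>j<2 ^ m. cylinder m j) = UNIV"
    using residue_less by (auto simp: cylinder_def)
  then have "1 = measure M (\<Union>j<2 ^ m. cylinder m j)"
    using prob_space by (simp add: space_M)
  also have "\<dots> = (\<Sum>j<2 ^ m. measure M (cylinder m j))"
    by (rule finite_measure_finite_Union) (auto simp: disjoint_family_on_def cylinder_def[of m] sets_M cyl[unfolded sets_M cylinder_def])
  also have "\<dots> = 2 ^ m * measure M (cylinder m (residue m y))"
    by (simp add: const)
  finally show ?thesis
    by (simp add: emeasure_eq_measure field_simps)
qed

text \<open>
  Haar measure on the 2-adic integers: the digits are independent and uniform.
\<close>

definition coin_measure :: "(nat \<Rightarrow> bool) measure" where
  "coin_measure = Pi\<^sub>M UNIV (\<lambda>_. measure_pmf (pmf_of_set UNIV))"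

lemma cylinder_eq_prod_emb:
  "cylinder m (residue m y) = prod_emb UNIV (\<lambda>_. measure_pmf p) {..<m} (Pi\<^sub>E {..<m} (\<lambda>k. {y k}))"
  unfolding cylinder_eq_PiE by (subst prod_emb_PiE) (simp_all cong: if_cong)

text \<open>
  Products of Borel sets are Borel by a general fact on countable products; conversely the cylinders,
  which generate the Borel sets, are finite-dimensional boxes.
\<close>

lemma sets_coin_measure: "sets coin_measure = sets borel"
proof
  have "sets (borel :: bool measure) = UNIV"
    by (simp add: sets_borel_eq_count_space)
  then have "sets coin_measure = sets (Pi\<^sub>M UNIV (\<lambda>_::nat. borel :: bool measure))"
    unfolding coin_measure_def by (intro sets_PiM_cong) simp_all
  then show "sets coin_measure \<subseteq> sets borel"
    using sets_PiM_subset_borel by simp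
next
  have "space coin_measure = UNIV"
    by (simp add: coin_measure_def space_PiM)
  have "cylinder m j \<in> sets coin_measure" for m j
  proof (cases "cylinder m j = {}")
    case False
    then obtain y where "j = residue m y"
      by (auto simp: cylinder_def)
    then show ?thesis
      unfolding coin_measure_def
      by (simp add: cylinder_eq_prod_emb[of m y "pmf_of_set UNIV"] sets_PiM_I)
  qed simp
  then have "range (\<lambda>(m, j). cylinder m j) \<subseteq> sets coin_measure"
    by auto
  then have "sigma_sets UNIV (range (\<lambda>(m, j). cylinder m j)) \<subseteq> sets coin_measure"
    using sets.sigma_sets_subset[of _ coin_measure] \<open>space coin_measure = UNIV\<close> by metis
  then show "sets borel \<subseteq> sets coin_measure"
    by (simp add: borel_eq_sigma_cylinders)
qed

lemma emeasure_coin_measure_cylinder: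
  "emeasure coin_measure (cylinder m (residue m y)) = ennreal (1 / 2 ^ m)"
proof -
  let ?p = "pmf_of_set (UNIV :: bool set)"
  have "emeasure coin_measure (cylinder m (residue m y)) = (\<Prod>k<m. emeasure (measure_pmf ?p) {y k})"
    unfolding coin_measure_def cylinder_eq_prod_emb[of m y ?p]
    by (intro emeasure_PiM_emb measure_pmf.prob_space_axioms) simp_all
  also have "\<dots> = (\<Prod>k<m. ennreal (1 / 2))"
    by (simp add: emeasure_pmf_single)
  also have "\<dots> = ennreal ((1 / 2) ^ m)"
    unfolding prod_constant card_lessThan by (rule ennreal_power) simp
  finally show ?thesis
    by (simp add: power_one_over)
qed

lemma invariant_coin_measure: "invariant_borel_prob UNIV odometer coin_measure"
proof -
  have prob: "prob_space coin_measure"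
    unfolding coin_measure_def by (intro prob_space_PiM measure_pmf.prob_space_axioms)
  have space: "space coin_measure = UNIV"
    using sets_eq_imp_space_eq[OF sets_coin_measure] by simp
  have odo: "odometer \<in> measurable coin_measure coin_measure"
    using measurable_odometer by (simp add: measurable_cong_sets[OF sets_coin_measure sets_coin_measure])
  have "distr coin_measure coin_measure odometer = coin_measure"
  proof (rule prob_measure_eqI_cylinders)
    fix m y
    \<comment> \<open>The preimage of a cylinder is another cylinder of the same level, hence of the same measure.\<close>
    have "emeasure (distr coin_measure coin_measure odometer) (cylinder m (residue m y)) =
        emeasure coin_measure (odometer -` cylinder m (residue m (odometer (odometer_inv y))))"
      using odo by (simp add: emeasure_distr sets_coin_measure open_cylinder space odometer_odometer_inv)
    then show "emeasure (distr coin_measure coin_measure odometer) (cylinder m (residue m y)) =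
        emeasure coin_measure (cylinder m (residue m y))"
      by (simp only: vimage_odometer_cylinder emeasure_coin_measure_cylinder)
  qed (use prob odo in \<open>simp_all add: sets_coin_measure prob_space.prob_space_distr\<close>)
  then show ?thesis
    using prob by (simp add: invariant_borel_prob_def sets_coin_measure)
qed

lemma uniquely_ergodic_odometer: "uniquely_ergodic UNIV odometer"
  unfolding uniquely_ergodic_def
proof (intro conjI self_homeomorphism_odometer)
  show "\<exists>!M. invariant_borel_prob UNIV odometer M"
  proof (rule ex1I)
    show inv: "invariant_borel_prob UNIV odometer coin_measure"
      by (rule invariant_coin_measure)
    fix M assume M: "invariant_borel_prob UNIV odometer M"
    show "M = coin_measure"
    proof (rule prob_measure_eqI_cylinders)
      show "emeasure M (cylinder m (residue m y)) = emeasure coin_measure (cylinder m (residue m y))" for m y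
        by (simp only: emeasure_cylinder_invariant[OF M] emeasure_cylinder_invariant[OF inv])
    qed (use M inv in \<open>simp_all add: invariant_borel_prob_def\<close>)
  qed
qed

theorem proposition2p1:
  fixes n :: nat and \<beta> :: "'a::euclidean_space \<Rightarrow> 'a"
  assumes "n \<ge> 3" and "odd n" and "DIM('a) = n + 1"
    and "minimal_homeomorphism (sphere 0 1) \<beta>"
  shows "\<exists>(X :: (nat \<Rightarrow> bool) set) (\<alpha> :: (nat \<Rightarrow> bool) \<Rightarrow> (nat \<Rightarrow> bool)).
           Cantor_set X \<and> minimal_homeomorphism X \<alpha> \<and> uniquely_ergodic X \<alpha> \<and>
           minimal_homeomorphism (X \<times> sphere 0 1) (\<lambda>(x, t). (\<alpha> x, \<beta> t))"
proof (intro exI conjI)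
  let ?S = "sphere (0::'a) 1"
  have \<beta>: "self_homeomorphism ?S \<beta>"
    using assms(4) by (simp add: minimal_homeomorphism_def)
  have "connected ?S"
    using assms(1,3) by (simp add: connected_sphere_eq)
  then show prod: "minimal_homeomorphism (UNIV \<times> ?S) (\<lambda>(x, t). (odometer x, \<beta> t))"
    using assms(4) by (intro minimal_homeomorphism_odometer_prod \<beta> minimal_homeomorphism_funpow_power2)
  have "\<beta> ` ?S = ?S"
    using \<beta> by (auto simp: self_homeomorphism_def homeomorphism_def)
  then show "minimal_homeomorphism UNIV odometer"
    by (intro minimal_homeomorphism_factor[OF prod] self_homeomorphism_odometer) simp_all
  show "Cantor_set (UNIV :: (nat \<Rightarrow> bool) set)"
    by (simp add: Cantor_set_def homeomorphic_refl)
  show "uniquely_ergodic UNIV odometer"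
    by (rule uniquely_ergodic_odometer)
qed

end
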